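(* First half-time slot ($d_1$ transmits to $d_2$ with power $P_1$, the cellular user $u$ transmits to the base station $b$ with power $P_u$). Put $A=h_d/h_{d_2,u}$ and $B=h_{b,d_1}/h_{b,u}$, and consider the problem of maximizing the D2D rate $R_{d_2}=W\log_2(1+P_1h_d/\sigma^2)$ over the transmit powers $(P_1,P_u)$ subject to $$W\log_2\Big(1+\frac{P_uh_{b,u}}{\sigma^2}\Big)\ge R_{u,min},\qquad P_1\le P_{1,M},\qquad P_u\le P_{u,M},\qquad A<\frac{P_u}{P_1}<B,$$ where, among the admissible values of $P_u$, the one giving a rate of $u$ closest to $R_{u,min}$ is selected. Let $P_{u,m}=(2^{R_{u,min}/W}-1)\sigma^2/h_{b,u}$. The power multiplexing conditions $A<P_u/P_1<B$ imply the rate condition for mutual interference cancellation, $h_{b,d_1}h_{d_2,u}>h_dh_{b,u}$, which is equivalent to $A<B$. If $P_{u,m}>P_{u,M}$ or $P_{1,M}<P_{u,m}/B$, the problem has no solution, even when $A<B$. Otherwise, when $A<B$, the problem is solved by increasing $P_1$ as much as possible and adjusting $P_u$ accordingly, which gives $$(P_1,P_u)=\begin{cases}(P_{1,M},\,P_{u,m}) & \text{if } P_{1,M}<P_{u,m}/A,\\ (P_{u,M}/A,\,P_{u,M}) & \text{if not, and if } AP_{1,M}>P_{u,M},\\ (P_{1,M},\,AP_{1,M}) & \text{otherwise.}\end{cases}$$ With this choice, $u$ always transmits at the minimum necessary power that respects the problem constraints. Second half-time slot ($d_2$ transmits to $d_1$ with power $P_2\le P_{2,M}$): the same holds with $P_1,P_{1,M},A,B$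 replaced by $P_2,P_{2,M},A',B'$, where $A'=h_d/h_{d_1,u}$ and $B'=h_{b,d_2}/h_{b,u}$, the multiplexing conditions being $A'<P_u/P_2<B'$ and the channel condition being $h_{d_1,u}h_{b,d_2}>h_{b,u}h_d$ (i.e. $A'<B'$).
   Context: This is half-duplex device-to-device (D2D) power allocation with mutual successive interference cancellation. Two devices $d_1,d_2$ share the uplink channel of a cellular user $u$ served by a base station $b$. The time slot is split into two equal halves, in which $d_1$ and $d_2$ alternately transmit to each other, and the power of $u$ may differ in the two halves. The positive numbers $h_d,h_{b,u},h_{b,d_j},h_{d_j,u}$ are the channel gains of the links $d_1$–$d_2$, $u$–$b$, $d_j$–$b$ and $u$–$d_j$; $\sigma^2$ is the noise power, $W$ the channel bandwidth, $R_{u,min}$ the target rate of $u$, and $P_{1,M},P_{2,M},P_{u,M}$ the maximum transmit powers of $d_1,d_2,u$. With mutual cancellation, the receiving device first decodes and removes the message of $u$, and $b$ first decodes and removes the message of the transmitting device, so the rates contain no interference terms. The power multiplexing conditions require that at each receiver the message decoded first has a higher power level than the remaining one: in the first half, $P_uh_{d_2,u}>P_1h_d$ and $P_1h_{b,d_1}>P_uh_{b,u}$, i.e. $A<P_u/P_1<B$. $P_{u,m}$ is the minimum power with which $u$ meets its target rate.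
   Formalization: Cases 2 and 3 give P_u/P_1 = A, violating the strict condition, and P_{1,M} = P_{u,m}/B is strictly infeasible; optimality is proved for A ≤ P_u/P_1 ≤ B and, if P_{u,m}/B < P_{1,M}, over the closure of the strict feasible set; case 1 with P_{u,m}/B < P_{1,M} is also proved strictly. *)

theory Defs
  imports "HOL-Analysis.Analysis"
begin

definition link_rate :: "real \<Rightarrow> real \<Rightarrow> real \<Rightarrow> real \<Rightarrow> real" where
  "link_rate W \<sigma> h P = W * log 2 (1 + P * h / \<sigma>\<^sup>2)"

definition min_user_power :: "real \<Rightarrow> real \<Rightarrow> real \<Rightarrow> real \<Rightarrow> real" where
  "min_user_power W \<sigma> h_bu R_min = (2 powr (R_min / W) - 1) * \<sigma>\<^sup>2 / h_bu"

text \<open>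
  Power pairs are \<open>(P, P\<^sub>u)\<close>, with \<open>P\<close> the power of the transmitting device and \<open>P\<^sub>u\<close> that of
  the cellular user; \<open>P_M\<close> and \<open>P_uM\<close> are their maximum values. Both powers are required to be
  positive, since the ratio is meaningless for \<open>P = 0\<close> and satisfied by pairs of negative numbers.
\<close>

definition feasible ::
  "real \<Rightarrow> real \<Rightarrow> real \<Rightarrow> real \<Rightarrow> real \<Rightarrow> real \<Rightarrow> real \<Rightarrow> real \<Rightarrow> (real \<times> real) set" where
  "feasible W \<sigma> h_bu R_min P_M P_uM A B =
     {(P, P\<^sub>u). 0 < P \<and> 0 < P\<^sub>u \<and> link_rate W \<sigma> h_bu P\<^sub>u \<ge> R_min \<and> P \<le> P_M \<and> P\<^sub>u \<le> P_uM
        \<and> A < P\<^sub>u / P \<and> P\<^sub>u / P < B}"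

text \<open>
  The closed form of the allocation may lie on the boundary \<open>P\<^sub>u / P = A\<close> or \<open>P\<^sub>u / P = B\<close>, which the
  strict multiplexing conditions exclude. Hence the same constraints with non-strict ones.
\<close>

definition feasible_closed ::
  "real \<Rightarrow> real \<Rightarrow> real \<Rightarrow> real \<Rightarrow> real \<Rightarrow> real \<Rightarrow> real \<Rightarrow> real \<Rightarrow> (real \<times> real) set" where
  "feasible_closed W \<sigma> h_bu R_min P_M P_uM A B =
     {(P, P\<^sub>u). 0 < P \<and> 0 < P\<^sub>u \<and> link_rate W \<sigma> h_bu P\<^sub>u \<ge> R_min \<and> P \<le> P_M \<and> P\<^sub>u \<le> P_uM
        \<and> A \<le> P\<^sub>u / P \<and> P\<^sub>u / P \<le> B}"

text \<open>
  Solutions of the problem over a set \<open>S\<close> of power pairs: the D2D rate is maximal over \<open>S\<close>, and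
  among the values of \<open>P\<^sub>u\<close> admissible with that \<open>P\<close> the rate of the user is closest to \<open>R_min\<close>.
\<close>

definition solutions ::
  "real \<Rightarrow> real \<Rightarrow> real \<Rightarrow> real \<Rightarrow> real \<Rightarrow> (real \<times> real) set \<Rightarrow> (real \<times> real) set" where
  "solutions W \<sigma> h_d h_bu R_min S =
     {(P, P\<^sub>u). (P, P\<^sub>u) \<in> S
        \<and> (\<forall>(Q, Q\<^sub>u) \<in> S. link_rate W \<sigma> h_d Q \<le> link_rate W \<sigma> h_d P)
        \<and> (\<forall>Q\<^sub>u. (P, Q\<^sub>u) \<in> S \<longrightarrow>
              \<bar>link_rate W \<sigma> h_bu P\<^sub>u - R_min\<bar> \<le> \<bar>link_rate W \<sigma> h_bu Q\<^sub>u - R_min\<bar>)}"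

definition allocation :: "real \<Rightarrow> real \<Rightarrow> real \<Rightarrow> real \<Rightarrow> real \<times> real" where
  "allocation A P_um P_M P_uM =
     (if P_M < P_um / A then (P_M, P_um)
      else if A * P_M > P_uM then (P_uM / A, P_uM)
      else (P_M, A * P_M))"

end

theory Submission
  imports Defs
begin

text \<open>
  The rate is strictly increasing in the power, so in terms of powers the rate condition reads
  \<open>P_um \<le> P\<^sub>u\<close> and all constraints are linear. Maximizing the D2D rate means maximizing \<open>P\<close>, whose
  only upper bounds are \<open>P_M\<close> and \<open>P_uM / A\<close> (from \<open>A P \<le> P\<^sub>u \<le> P_uM\<close>), and the user rate closest
  to its target is reached at the least admissible \<open>P\<^sub>u\<close>, which is \<open>max P_um (A P)\<close>. Passing from
  strict to non-strict multiplexing conditions amounts to taking the closure, by convexity; the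
  only further point of the closure can be the origin (when \<open>P_um = 0\<close>), where the D2D rate is not maximal.
\<close>

section \<open>Translation between rates and powers\<close>

lemma link_rate_less_iff:
  assumes "W > 0" "\<sigma> > 0" "h > 0" "P \<ge> 0" "Q \<ge> 0"
  shows "link_rate W \<sigma> h P < link_rate W \<sigma> h Q \<longleftrightarrow> P < Q"
proof -
  have "1 + P * h / \<sigma>\<^sup>2 > 0" "1 + Q * h / \<sigma>\<^sup>2 > 0"
    using assms by (simp_all add: add_pos_nonneg)
  then show ?thesis
    using assms by (simp add: link_rate_def divide_less_cancel)
qed

lemma link_rate_le_iff:
  assumes "W > 0" "\<sigma> > 0" "h > 0" "P \<ge> 0" "Q \<ge> 0"
  shows "link_rate W \<sigma> h P \<le> link_rate W \<sigma> h Q \<longleftrightarrow> P \<le> Q"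
  using link_rate_less_iff[of W \<sigma> h Q P] assms by (simp add: not_less[symmetric])

lemma min_user_power_nonneg:
  assumes "W > 0" "h > 0" "R \<ge> 0"
  shows "min_user_power W \<sigma> h R \<ge> 0"
  using assms by (simp add: min_user_power_def ge_one_powr_ge_zero)

lemma link_rate_min_user_power:
  assumes "W > 0" "\<sigma> > 0" "h > 0"
  shows "link_rate W \<sigma> h (min_user_power W \<sigma> h R) = R"
  using assms by (simp add: link_rate_def min_user_power_def)

lemma link_rate_ge_iff:
  assumes "W > 0" "\<sigma> > 0" "h > 0" "R \<ge> 0" "P \<ge> 0"
  shows "R \<le> link_rate W \<sigma> h P \<longleftrightarrow> min_user_power W \<sigma> h R \<le> P"
  using link_rate_le_iff[OF assms(1-3) min_user_power_nonneg assms(5), of W h R \<sigma>] assms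
  by (simp add: link_rate_min_user_power)

text \<open>Every user rate on \<open>S\<close> is at least \<open>R_min\<close>, so the absolute
  gap is the excess of the rate and grows with the user power. Optimality thus becomes a
  lexicographic choice: greatest \<open>P\<close>, then least \<open>P\<^sub>u\<close>, and strict
  monotonicity of the rates makes the optimum unique.\<close>

lemma solutions_eq_singleton:
  assumes "W > 0" "\<sigma> > 0" "h_d > 0" "h_bu > 0" "R_min \<ge> 0"
    and opt: "(p, u) \<in> S"
    and S: "\<And>P P\<^sub>u. (P, P\<^sub>u) \<in> S \<Longrightarrow> 0 \<le> P \<and> P \<le> p \<and> min_user_power W \<sigma> h_bu R_min \<le> P\<^sub>u"
    and least: "\<And>P\<^sub>u. (p, P\<^sub>u) \<in> S \<Longrightarrow> u \<le> P\<^sub>u"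
  shows "solutions W \<sigma> h_d h_bu R_min S = {(p, u)}"
proof -
  have m: "0 \<le> min_user_power W \<sigma> h_bu R_min"
    using assms by (simp add: min_user_power_nonneg)
  have nonneg: "0 \<le> P\<^sub>u" if "(P, P\<^sub>u) \<in> S" for P P\<^sub>u
    using S[OF that] m by linarith
  have gap: "\<bar>link_rate W \<sigma> h_bu P\<^sub>u - R_min\<bar> = link_rate W \<sigma> h_bu P\<^sub>u - R_min"
    if "(P, P\<^sub>u) \<in> S" for P P\<^sub>u
    using S[OF that] nonneg[OF that] link_rate_ge_iff[of W \<sigma> h_bu R_min P\<^sub>u] assms by auto
  show ?thesis
  proof (intro equalityI subsetI)
    fix x assume "x \<in> solutions W \<sigma> h_d h_bu R_min S"
    then obtain P P\<^sub>u where x: "x = (P, P\<^sub>u)" and PS: "(P, P\<^sub>u) \<in> S"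
      and max: "link_rate W \<sigma> h_d p \<le> link_rate W \<sigma> h_d P"
      and closest: "\<And>Q\<^sub>u. (P, Q\<^sub>u) \<in> S \<Longrightarrow>
        \<bar>link_rate W \<sigma> h_bu P\<^sub>u - R_min\<bar> \<le> \<bar>link_rate W \<sigma> h_bu Q\<^sub>u - R_min\<bar>"
      using opt unfolding solutions_def by blast
    have P: "P = p"
      using max S[OF PS] S[OF opt] assms by (simp add: link_rate_le_iff)
    have "link_rate W \<sigma> h_bu P\<^sub>u \<le> link_rate W \<sigma> h_bu u"
      using closest[of u] gap[OF PS] gap[OF opt] opt P by simp
    then have "P\<^sub>u \<le> u"
      using nonneg[OF PS] nonneg[OF opt] assms by (simp add: link_rate_le_iff)
    then show "x \<in> {(p, u)}"
      using least PS P x by fastforce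
  next
    fix x assume x: "x \<in> {(p, u)}"
    have "link_rate W \<sigma> h_d Q \<le> link_rate W \<sigma> h_d p" if "(Q, Q\<^sub>u) \<in> S" for Q Q\<^sub>u
      using S[OF that] S[OF opt] assms by (simp add: link_rate_le_iff)
    moreover have "\<bar>link_rate W \<sigma> h_bu u - R_min\<bar> \<le> \<bar>link_rate W \<sigma> h_bu Q\<^sub>u - R_min\<bar>"
      if "(p, Q\<^sub>u) \<in> S" for Q\<^sub>u
      unfolding gap[OF that] gap[OF opt]
      using least[OF that] nonneg[OF that] nonneg[OF opt] assms by (simp add: link_rate_le_iff)
    ultimately show "x \<in> solutions W \<sigma> h_d h_bu R_min S"
      using x opt unfolding solutions_def by auto
  qed
qed

section \<open>One half-slot, with arbitrary positive ratio bounds\<close>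

locale half_slot =
  fixes h_d h_bu \<sigma> W R_min P_M P_uM A B :: real
  assumes pos: "h_d > 0" "h_bu > 0" "\<sigma> > 0" "W > 0" "R_min \<ge> 0" "P_M > 0" "P_uM > 0" "A > 0" "B > 0"
begin

abbreviation "P_um \<equiv> min_user_power W \<sigma> h_bu R_min"
abbreviation "F \<equiv> feasible W \<sigma> h_bu R_min P_M P_uM A B"
abbreviation "C \<equiv> feasible_closed W \<sigma> h_bu R_min P_M P_uM A B"
abbreviation "Sol \<equiv> solutions W \<sigma> h_d h_bu R_min"
abbreviation "opt \<equiv> allocation A P_um P_M P_uM"

text \<open>A closed set containing \<open>F\<close> and \<open>C\<close>, hence also
  \<open>closure F\<close>, so that the bounds on optimal powers are proved once for all three.
  Products instead of ratios keep the constraints meaningful at \<open>P = 0\<close>.\<close>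

definition "relaxation = {(P, P\<^sub>u). 0 \<le> P \<and> P \<le> P_M \<and> P_um \<le> P\<^sub>u \<and> P\<^sub>u \<le> P_uM \<and> A * P \<le> P\<^sub>u \<and> P\<^sub>u \<le> B * P}"

lemma P_um_nonneg: "0 \<le> P_um"
  using pos by (simp add: min_user_power_nonneg)

lemma mem_F_iff:
  "(P, P\<^sub>u) \<in> F \<longleftrightarrow>
     0 < P \<and> 0 < P\<^sub>u \<and> P_um \<le> P\<^sub>u \<and> P \<le> P_M \<and> P\<^sub>u \<le> P_uM \<and> A * P < P\<^sub>u \<and> P\<^sub>u < B * P"
  using link_rate_ge_iff[of W \<sigma> h_bu R_min P\<^sub>u] pos
  by (auto simp: feasible_def field_simps)

lemma mem_C_iff:
  "(P, P\<^sub>u) \<in> C \<longleftrightarrow>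
     0 < P \<and> 0 < P\<^sub>u \<and> P_um \<le> P\<^sub>u \<and> P \<le> P_M \<and> P\<^sub>u \<le> P_uM \<and> A * P \<le> P\<^sub>u \<and> P\<^sub>u \<le> B * P"
  using link_rate_ge_iff[of W \<sigma> h_bu R_min P\<^sub>u] pos
  by (auto simp: feasible_closed_def field_simps)

lemma F_subset_C: "F \<subseteq> C"
  by (auto simp: mem_F_iff mem_C_iff)

lemma C_subset_relaxation: "C \<subseteq> relaxation"
  by (auto simp: mem_C_iff relaxation_def)

lemma closed_relaxation: "closed relaxation"
  unfolding relaxation_def case_prod_beta
  by (intro closed_Collect_conj closed_Collect_le continuous_intros)

lemma closure_F_subset_relaxation: "closure F \<subseteq> relaxation"
  using F_subset_C C_subset_relaxation closed_relaxation by (intro closure_minimal) auto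

lemma C_empty:
  assumes "P_uM < P_um \<or> P_M < P_um / B"
  shows "C = {}"
proof -
  have False if "(P, P\<^sub>u) \<in> C" for P P\<^sub>u
  proof -
    have "P \<le> P_M" "P\<^sub>u \<le> B * P" "P_um \<le> P\<^sub>u" "P\<^sub>u \<le> P_uM"
      using that by (auto simp: mem_C_iff)
    moreover have "B * P \<le> B * P_M"
      using \<open>P \<le> P_M\<close> pos by simp
    moreover have "P_uM < P_um \<or> B * P_M < P_um"
      using assms pos by (simp add: field_simps)
    ultimately show False by linarith
  qed
  then show ?thesis by auto
qed

text \<open>In the last two cases of \<open>allocation\<close> the ratio is exactly
  \<open>A\<close>. In the first it is \<open>P_um / P_M\<close>, above \<open>A\<close> by the case
  condition and at most \<open>B\<close> because \<open>P_um / B \<le> P_M\<close>.\<close>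

lemma opt_in_C:
  assumes "P_um \<le> P_uM" "P_um / B \<le> P_M" "A < B"
  shows "opt \<in> C"
proof -
  have "A * P_M < B * P_M" "A * P_uM < B * P_uM"
    using assms pos by simp_all
  \<comment> \<open>\<open>P_um\<close> vanishes when \<open>R_min = 0\<close>, but never in the
    case where it is the allocated user power.\<close>
  moreover have "0 < P_um" if "P_M < P_um / A"
    using that pos by (metis less_trans zero_less_divide_iff less_asym)
  ultimately show ?thesis
    using assms pos by (auto simp: allocation_def mem_C_iff field_simps)
qed

text \<open>\<open>fst opt\<close> is always one of the two upper bounds \<open>P_M\<close> and
  \<open>P_uM / A\<close> on \<open>P\<close>.\<close>

lemma relaxation_le_opt:
  assumes "(P, P\<^sub>u) \<in> relaxation"
  shows "P \<le> fst opt"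
proof -
  have "A * P \<le> P_uM" "P \<le> P_M"
    using assms by (auto simp: relaxation_def)
  then show ?thesis
    using pos by (auto simp: allocation_def field_simps)
qed

text \<open>\<open>snd opt\<close> is \<open>P_um\<close> in the first case and
  \<open>A * fst opt\<close> in the others, and both are lower bounds on the user power.\<close>

lemma opt_least_user_power:
  assumes "(fst opt, P\<^sub>u) \<in> relaxation"
  shows "snd opt \<le> P\<^sub>u"
  using assms pos by (auto simp: allocation_def relaxation_def split: if_splits)

lemma Sol_eq_opt:
  assumes "opt \<in> S" "S \<subseteq> relaxation"
  shows "Sol S = {opt}"
proof -
  have "Sol S = {(fst opt, snd opt)}"
    using assms pos relaxation_le_opt opt_least_user_power
    by (intro solutions_eq_singleton) (auto simp: relaxation_def)
  then show ?thesis by simp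
qed

lemma F_nonempty:
  assumes "P_um \<le> P_uM" "P_um / B < P_M" "A < B"
  shows "F \<noteq> {}"
proof -
  \<comment> \<open>The user power is chosen first. \<open>P_um\<close> itself serves unless it is
    zero; then a small positive value does, where the factor 1/2 makes \<open>v / B < P_M\<close>
    strict.\<close>
  obtain v where v: "0 < v" "P_um \<le> v" "v \<le> P_uM" "v / B < P_M"
  proof (cases "P_um = 0")
    case True
    have "min P_uM (B * P_M / 2) / B < P_M"
      using pos by (auto simp: field_simps min_def)
    then show ?thesis
      using that[of "min P_uM (B * P_M / 2)"] True pos by auto
  next
    case False
    then show ?thesis
      using that[of P_um] assms P_um_nonneg by auto
  qed
  \<comment> \<open>For fixed \<open>v\<close>, the multiplexing conditions confine \<open>P\<close>
    to the interval from \<open>v / B\<close> to \<open>v / A\<close>, which is nonempty as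
    \<open>A < B\<close>.\<close>
  have "v / B < min P_M (v / A)"
    using v assms pos by (simp add: frac_less2)
  then obtain P where P: "v / B < P" "P < min P_M (v / A)"
    using dense by blast
  moreover have "0 < P"
    using P(1) v(1) pos by (meson divide_pos_pos less_trans)
  ultimately have "(P, v) \<in> F"
    using v pos by (auto simp: mem_F_iff field_simps)
  then show ?thesis by auto
qed

text \<open>The segment from a point of \<open>C\<close> to a point of \<open>F\<close> lies in
  \<open>F\<close> apart possibly from its starting point, which is therefore a limit of points of
  \<open>F\<close>.\<close>

lemma C_subset_closure_F:
  assumes "F \<noteq> {}"
  shows "C \<subseteq> closure F"
proof
  fix x assume "x \<in> C"
  obtain P P\<^sub>u where x: "x = (P, P\<^sub>u)" by (cases x)
  obtain q v where q: "(q, v) \<in> F" using assms by auto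
  have seg: "(1 - t) *\<^sub>R x + t *\<^sub>R (q, v) \<in> F" if t: "0 < t" "t < 1" for t :: real
  proof -
    note c = \<open>x \<in> C\<close>[unfolded x mem_C_iff] and f = q[unfolded mem_F_iff]
    have le: "(1 - t) * a + t * b \<le> d" if "a \<le> d" "b \<le> d" for a b d :: real
      using convex_bound_le[OF that, of "1 - t" t] t by simp
    have ge: "d \<le> (1 - t) * a + t * b" if "d \<le> a" "d \<le> b" for a b d :: real
      using le[of "- a" "- d" "- b"] that by simp
    \<comment> \<open>The strict inequality at the end in \<open>F\<close> has positive weight
      \<open>t\<close>, so it makes the combined inequality strict.\<close>
    have less: "(1 - t) * a + t * b < (1 - t) * a' + t * b'" if "a \<le> a'" "b < b'" for a b a' b' :: real
      using t that by (intro add_le_less_mono mult_left_mono mult_strict_left_mono) auto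
    have "A * ((1 - t) * P + t * q) < (1 - t) * P\<^sub>u + t * v"
      "(1 - t) * P\<^sub>u + t * v < B * ((1 - t) * P + t * q)"
      using c f less[of "A * P" P\<^sub>u "A * q" v] less[of P\<^sub>u "B * P" v "B * q"]
      by (simp_all add: algebra_simps)
    moreover have "0 < (1 - t) * P + t * q" "0 < (1 - t) * P\<^sub>u + t * v"
      using c f t by (simp_all add: add_pos_pos)
    ultimately show ?thesis
      using c f by (simp add: x mem_F_iff le ge)
  qed
  have "((\<lambda>t::real. (1 - t) *\<^sub>R x + t *\<^sub>R (q, v)) \<longlongrightarrow> (1 - 0) *\<^sub>R x + 0 *\<^sub>R (q, v)) (at_right 0)"
    by (intro tendsto_intros)
  then have lim: "((\<lambda>t::real. (1 - t) *\<^sub>R x + t *\<^sub>R (q, v)) \<longlongrightarrow> x) (at_right 0)"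
    by (simp flip: zero_prod_def)
  have "eventually (\<lambda>t::real. (1 - t) *\<^sub>R x + t *\<^sub>R (q, v) \<in> closure F) (at_right 0)"
    using seg closure_subset[of F] by (intro eventually_at_rightI[of 0 1]) auto
  then show "x \<in> closure F"
    using lim by (intro Lim_in_closed_set[OF closed_closure _ trivial_limit_at_right_real])
qed

text \<open>Only the first case of \<open>allocation\<close> can avoid the boundary: in the others
  the ratio equals \<open>A\<close>, which \<open>F\<close> excludes.\<close>

lemma opt_in_F:
  assumes "P_um \<le> P_uM" "P_um / B < P_M" "P_M < P_um / A"
  shows "opt \<in> F"
proof -
  have less: "A * P_M < P_um" "P_um < B * P_M"
    using assms pos by (simp_all add: field_simps)
  moreover have "0 < P_um"
    using less(1) pos by (meson less_trans mult_pos_pos)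
  ultimately show ?thesis
    using assms pos by (simp add: allocation_def mem_F_iff)
qed

text \<open>The claims on \<open>F\<close> assume \<open>P_um / B < P_M\<close> because at equality
  \<open>F\<close> is empty, by \<open>P_um \<le> P\<^sub>u < B * P \<le> B * P_M\<close>, while
  \<open>C\<close> can still contain \<open>(P_M, P_um)\<close>.\<close>

theorem half_slot_optimum:
  "(P_um > P_uM \<or> P_M < P_um / B \<longrightarrow> F = {} \<and> C = {})
   \<and> (\<not> (P_um > P_uM \<or> P_M < P_um / B) \<and> A < B \<longrightarrow>
        Sol C = {opt}
      \<and> (P_um / B < P_M \<longrightarrow> F \<noteq> {} \<and> Sol (closure F) = {opt})
      \<and> (P_um / B < P_M \<and> P_M < P_um / A \<longrightarrow> Sol F = {opt})
      \<and> (\<forall>Q\<^sub>u. (fst opt, Q\<^sub>u) \<in> C \<longrightarrow> snd opt \<le> Q\<^sub>u))"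
proof (intro conjI impI allI; (elim conjE)?)
  assume "P_um > P_uM \<or> P_M < P_um / B"
  then show "C = {}" by (rule C_empty)
  then show "F = {}" using F_subset_C by simp
next
  assume solvable: "\<not> (P_um > P_uM \<or> P_M < P_um / B)" "A < B"
  then have opt: "opt \<in> C" by (intro opt_in_C) auto
  then show "Sol C = {opt}"
    using C_subset_relaxation by (rule Sol_eq_opt)
  show "snd opt \<le> Q\<^sub>u" if "(fst opt, Q\<^sub>u) \<in> C" for Q\<^sub>u
    using that C_subset_relaxation by (intro opt_least_user_power) auto
  assume "P_um / B < P_M"
  then show F: "F \<noteq> {}"
    using solvable by (intro F_nonempty) auto
  show "Sol (closure F) = {opt}"
    using opt C_subset_closure_F[OF F] closure_F_subset_relaxation by (intro Sol_eq_opt) auto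
next
  assume "\<not> (P_um > P_uM \<or> P_M < P_um / B)" "P_um / B < P_M" "P_M < P_um / A"
  then show "Sol F = {opt}"
    using F_subset_C C_subset_relaxation by (intro Sol_eq_opt opt_in_F) auto
qed

end

section \<open>The channel conditions and the two half-slots\<close>

lemma divide_less_divide_iff_mult:
  fixes a b c d :: real
  assumes "b > 0" "d > 0"
  shows "c * b > a * d \<longleftrightarrow> a / b < c / d"
  using assms by (simp add: field_simps)

theorem mainTheorem6:
  fixes h_d h_bu h_bd1 h_bd2 h_d1u h_d2u \<sigma> W R_min P_1M P_2M P_uM :: real
  assumes "h_d > 0" "h_bu > 0" "h_bd1 > 0" "h_bd2 > 0" "h_d1u > 0" "h_d2u > 0"
    and "\<sigma> > 0" "W > 0" "R_min \<ge> 0"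
    and "P_1M > 0" "P_2M > 0" "P_uM > 0"
  shows
    "(let A = h_d / h_d2u; B = h_bd1 / h_bu;
          P_um = min_user_power W \<sigma> h_bu R_min;
          F = feasible W \<sigma> h_bu R_min P_1M P_uM A B;
          C = feasible_closed W \<sigma> h_bu R_min P_1M P_uM A B;
          Sol = solutions W \<sigma> h_d h_bu R_min;
          opt = allocation A P_um P_1M P_uM
      in (\<forall>P P\<^sub>u. 0 < P \<and> 0 < P\<^sub>u \<and> A < P\<^sub>u / P \<and> P\<^sub>u / P < B \<longrightarrow> h_bd1 * h_d2u > h_d * h_bu)
       \<and> (h_bd1 * h_d2u > h_d * h_bu \<longleftrightarrow> A < B)
       \<and> (P_um > P_uM \<or> P_1M < P_um / B \<longrightarrow> F = {} \<and> C = {})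
       \<and> (\<not> (P_um > P_uM \<or> P_1M < P_um / B) \<and> A < B \<longrightarrow>
            Sol C = {opt}
          \<and> (P_um / B < P_1M \<longrightarrow> F \<noteq> {} \<and> Sol (closure F) = {opt})
          \<and> (P_um / B < P_1M \<and> P_1M < P_um / A \<longrightarrow> Sol F = {opt})
          \<and> (\<forall>Q\<^sub>u. (fst opt, Q\<^sub>u) \<in> C \<longrightarrow> snd opt \<le> Q\<^sub>u)))
   \<and> (let A = h_d / h_d1u; B = h_bd2 / h_bu;
          P_um = min_user_power W \<sigma> h_bu R_min;
          F = feasible W \<sigma> h_bu R_min P_2M P_uM A B;
          C = feasible_closed W \<sigma> h_bu R_min P_2M P_uM A B;
          Sol = solutions W \<sigma> h_d h_bu R_min;
          opt = allocation A P_um P_2M P_uM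
      in (\<forall>P P\<^sub>u. 0 < P \<and> 0 < P\<^sub>u \<and> A < P\<^sub>u / P \<and> P\<^sub>u / P < B \<longrightarrow> h_bd2 * h_d1u > h_d * h_bu)
       \<and> (h_bd2 * h_d1u > h_d * h_bu \<longleftrightarrow> A < B)
       \<and> (P_um > P_uM \<or> P_2M < P_um / B \<longrightarrow> F = {} \<and> C = {})
       \<and> (\<not> (P_um > P_uM \<or> P_2M < P_um / B) \<and> A < B \<longrightarrow>
            Sol C = {opt}
          \<and> (P_um / B < P_2M \<longrightarrow> F \<noteq> {} \<and> Sol (closure F) = {opt})
          \<and> (P_um / B < P_2M \<and> P_2M < P_um / A \<longrightarrow> Sol F = {opt})
          \<and> (\<forall>Q\<^sub>u. (fst opt, Q\<^sub>u) \<in> C \<longrightarrow> snd opt \<le> Q\<^sub>u)))"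
proof -
  interpret first: half_slot h_d h_bu \<sigma> W R_min P_1M P_uM "h_d / h_d2u" "h_bd1 / h_bu"
    using assms by unfold_locales auto
  interpret second: half_slot h_d h_bu \<sigma> W R_min P_2M P_uM "h_d / h_d1u" "h_bd2 / h_bu"
    using assms by unfold_locales auto
  have channel: "h_bd1 * h_d2u > h_d * h_bu \<longleftrightarrow> h_d / h_d2u < h_bd1 / h_bu"
    "h_bd2 * h_d1u > h_d * h_bu \<longleftrightarrow> h_d / h_d1u < h_bd2 / h_bu"
    using assms by (simp_all add: divide_less_divide_iff_mult)
  \<comment> \<open>Rewriting with \<open>channel\<close> turns each channel equivalence into a
    reflexive one, and each first conjunct into \<open>A < B\<close>, which follows by transitivity
    through \<open>P\<^sub>u / P\<close>.\<close>
  show ?thesis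
    unfolding Let_def channel
    by (intro conjI[OF conjI[OF _ conjI[OF refl first.half_slot_optimum]]
          conjI[OF _ conjI[OF refl second.half_slot_optimum]]] allI impI; elim conjE; rule less_trans)
qed

end
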